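(* Let $m\ge1$ be a fixed integer and let $P_n=m\sum_{k=1}^nD_k$ be the internal path length of the $m$-ary recursive tree when the highest label in the tree is $n$. Then $$\mathbb E[P_n]=(m(n-1)+1)\,\mathcal H^{(1)}_{n-1}\Big(\frac1m\Big)= mn\ln(n)-m\,\psi\Big(\frac{m+1}{m}\Big)n+o(n),$$ where the first equality is exact for $n\ge 1$ and the second is an asymptotic expansion as $n\to\infty$.
   Context: Fix an integer $m\ge 1$. The $m$-ary recursive tree grows as follows. It starts as a single root node labeled $1$. For each $n\ge 1$, given the tree with highest label $n$ (which has $m(n-1)+1$ nodes), one of its nodes is selected uniformly at random, and $m$ new nodes, all receiving the label $n+1$, are attached as children of the selected node. The depth of a node is its edge distance to the root; all nodes labeled $k$ have the same depth, denoted $D_k$ (so $D_1=0$). The internal path length is the sum of the depths of all nodes. For real $y>0$, $\mathcal H^{(1)}_n(y)=\sum_{i=1}^n\frac{1}{i+y}$ (with $\mathcal H^{(1)}_0(y)=0$), and $\psi(x)=\frac{d}{dx}\ln\Gamma(x)$ is the digamma function. *)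

theory Defs
  imports "HOL-Probability.Probability" "HOL-Library.Landau_Symbols"
begin

text \<open>A node is a pair of its label and an index that distinguishes the nodes of equal label.
  A tree is given by its node set and its edges, directed from parent to child.\<close>

type_synonym node = "nat \<times> nat"

datatype tree = Tree (nodes: "node set") (edges: "(node \<times> node) set")

definition label :: "node \<Rightarrow> nat" where
  "label v = fst v"

definition root :: node where
  "root = (1, 0)"

definition attach :: "nat \<Rightarrow> nat \<Rightarrow> node \<Rightarrow> tree \<Rightarrow> tree" where
  "attach m k p t =
     (let N = {k} \<times> {..<m} in Tree (nodes t \<union> N) (edges t \<union> {p} \<times> N))"

text \<open>The distribution of the \<open>m\<close>-ary recursive tree with highest label \<open>n\<close>, for \<open>n \<ge> 1\<close>;
  the value at \<open>n = 0\<close> is irrelevant.\<close>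

fun recursive_tree :: "nat \<Rightarrow> nat \<Rightarrow> tree pmf" where
  "recursive_tree m 0 = return_pmf (Tree {root} {})"
| "recursive_tree m (Suc 0) = return_pmf (Tree {root} {})"
| "recursive_tree m (Suc (Suc n)) =
     bind_pmf (recursive_tree m (Suc n)) (\<lambda>t.
       map_pmf (\<lambda>p. attach m (Suc (Suc n)) p t) (pmf_of_set (nodes t)))"

definition edge_dist :: "tree \<Rightarrow> node \<Rightarrow> node \<Rightarrow> nat" where
  "edge_dist t u v = (LEAST d. (u, v) \<in> (edges t \<union> (edges t)\<inverse>) ^^ d)"

definition depth :: "tree \<Rightarrow> node \<Rightarrow> nat" where
  "depth t v = edge_dist t root v"

text \<open>The common depth \<open>D\<^sub>k\<close> of all nodes labeled \<open>k\<close>. It does not change as the tree grows further,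
  so it can be read off from the tree with any highest label \<open>n \<ge> k\<close>.\<close>

definition label_depth :: "tree \<Rightarrow> nat \<Rightarrow> nat" where
  "label_depth t k = (THE d. \<forall>v\<in>nodes t. label v = k \<longrightarrow> depth t v = d)"

definition internal_path_length :: "tree \<Rightarrow> nat" where
  "internal_path_length t = (\<Sum>v\<in>nodes t. depth t v)"

definition gen_harm :: "nat \<Rightarrow> real \<Rightarrow> real" where
  "gen_harm n y = (\<Sum>i=1..n. 1 / (real i + y))"

end

theory Submission
  imports Defs "HOL-Real_Asymp.Real_Asymp"
begin

text \<open>Attaching \<open>m\<close> children to a node of depth \<open>d\<close> increases the path length by \<open>m (d + 1)\<close>. For a
  uniformly chosen node of a tree with \<open>N\<close> nodes, the mean of \<open>d\<close> is the current path length divided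
  by \<open>N\<close>, so the expected path length per node grows by \<open>m / (N + m)\<close> in each step, and these
  increments sum to the shifted harmonic number. The expansion then follows from
  \<open>ln n - H\<^sub>n(1/m) \<longlonglongrightarrow> \<psi>(1 + 1/m)\<close>.\<close>

section \<open>Graph distance from the root\<close>

text \<open>A function that grows by one along each edge certifies depths: it bounds the length of every
  undirected walk from below, and the directed path attains the bound.\<close>

definition depth_certificate :: "tree \<Rightarrow> (node \<Rightarrow> nat) \<Rightarrow> bool" where
  "depth_certificate t d \<longleftrightarrow> d root = 0 \<and> edges t \<subseteq> nodes t \<times> nodes t \<and>
     (\<forall>(u, v)\<in>edges t. d v = Suc (d u)) \<and> (\<forall>v\<in>nodes t. (root, v) \<in> edges t ^^ d v)"

lemma depth_eq_certificate:
  assumes c: "depth_certificate t d" and v: "v \<in> nodes t"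
  shows "depth t v = d v"
proof -
  let ?S = "edges t \<union> (edges t)\<inverse>"
  have walk: "d w \<le> d u + k" if "(u, w) \<in> ?S ^^ k" for u w k
    using that
  proof (induction k arbitrary: w)
    case (Suc k)
    then obtain x where x: "(u, x) \<in> ?S ^^ k" "(x, w) \<in> ?S" by auto
    \<comment> \<open>Traversed backwards an edge lowers \<open>d\<close>, so a step in either
      direction raises it by at most one.\<close>
    have "d w \<le> Suc (d x)" using c x(2) unfolding depth_certificate_def by fastforce
    with Suc.IH[OF x(1)] show ?case by simp
  qed simp
  have "edges t ^^ k \<subseteq> ?S ^^ k" for k
    by (induction k) auto
  then have "(root, v) \<in> ?S ^^ d v"
    using c v unfolding depth_certificate_def by blast
  moreover have "d v \<le> k" if "(root, v) \<in> ?S ^^ k" for k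
    using walk[OF that] c unfolding depth_certificate_def by simp
  ultimately show ?thesis
    unfolding depth_def edge_dist_def by (rule Least_equality)
qed

text \<open>A certificate agrees with \<open>depth t\<close> on nodes, and edges join nodes only, so
  its properties transfer. Invariants can thus speak of \<open>depth t\<close> itself, without an
  auxiliary function.\<close>

lemma depth_certificate_depth:
  assumes c: "depth_certificate t d" and r: "root \<in> nodes t"
  shows "depth_certificate t (depth t)"
proof -
  have eq: "depth t v = d v" if "v \<in> nodes t" for v
    using depth_eq_certificate[OF c that] .
  have "depth t v = Suc (depth t u)" if "(u, v) \<in> edges t" for u v
  proof -
    have "u \<in> nodes t" "v \<in> nodes t" "d v = Suc (d u)"
      using c that by (auto simp: depth_certificate_def)
    then show ?thesis by (simp add: eq)
  qed
  then show ?thesis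
    using c r by (auto simp: depth_certificate_def eq)
qed

section \<open>The invariant of the growth process\<close>

text \<open>The root stands apart because label 1 has a single bearer, whereas each later label has
  \<open>m\<close>. The last conjunct is what makes the definite description in
  \<open>label_depth\<close> meaningful.\<close>

definition grown_tree :: "nat \<Rightarrow> nat \<Rightarrow> tree \<Rightarrow> bool" where
  "grown_tree m n t \<longleftrightarrow> nodes t = insert root ({2..n} \<times> {..<m}) \<and> depth_certificate t (depth t) \<and>
     (\<forall>u\<in>nodes t. \<forall>v\<in>nodes t. label u = label v \<longrightarrow> depth t u = depth t v)"

lemma grown_treeD:
  assumes "grown_tree m n t"
  shows "nodes t = insert root ({2..n} \<times> {..<m})" "depth_certificate t (depth t)"
    "\<And>u v. u \<in> nodes t \<Longrightarrow> v \<in> nodes t \<Longrightarrow> label u = label v \<Longrightarrow> depth t u = depth t v"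
  using assms unfolding grown_tree_def by blast+

lemma grown_tree_root: "grown_tree m (Suc 0) (Tree {root} {})"
proof -
  have "depth_certificate (Tree {root} {}) (\<lambda>_. 0)"
    by (simp add: depth_certificate_def)
  from depth_eq_certificate[OF this, of root]
  show ?thesis by (simp add: grown_tree_def depth_certificate_def)
qed

lemma grown_tree_nodes:
  assumes "grown_tree m n t"
  shows "finite (nodes t)" "root \<in> nodes t" "card (nodes t) = Suc (m * (n - 1))"
proof -
  have "nodes t = insert root ({2..n} \<times> {..<m})" "root \<notin> {2..n} \<times> {..<m}"
    using grown_treeD(1)[OF assms] by (auto simp: root_def)
  then show "finite (nodes t)" "root \<in> nodes t" "card (nodes t) = Suc (m * (n - 1))"
    by (auto simp: card_cartesian_product)
qed

lemma grown_tree_set_pmf: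
  assumes "grown_tree m n t"
  shows "set_pmf (pmf_of_set (nodes t)) = nodes t"
  using grown_tree_nodes[OF assms] by (auto intro!: set_pmf_of_set)

text \<open>New leaves hang one level below \<open>p\<close> and old edges survive. So old directed
  paths remain, the path to \<open>p\<close> extends to each new node, and the old depths extend to
  a certificate of the larger tree.\<close>

lemma depth_attach:
  assumes g: "grown_tree m n t" and p: "p \<in> nodes t" and n: "n \<ge> 1"
  defines "N \<equiv> {Suc n} \<times> {..<m}"
  defines "d \<equiv> \<lambda>v. if v \<in> N then Suc (depth t p) else depth t v"
  shows "depth_certificate (attach m (Suc n) p t) d"
    and "\<And>v. v \<in> nodes t \<union> N \<Longrightarrow> depth (attach m (Suc n) p t) v = d v"
    and "nodes t \<inter> N = {}"
proof -
  let ?t = "attach m (Suc n) p t"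
  have nd: "nodes ?t = nodes t \<union> N" and ed: "edges ?t = edges t \<union> {p} \<times> N"
    by (auto simp: attach_def N_def Let_def)
  \<comment> \<open>Here \<open>n \<ge> 1\<close> matters: for \<open>n = 0\<close> the new label
    would be 1, the label of the root.\<close>
  show disj: "nodes t \<inter> N = {}"
    unfolding grown_treeD(1)[OF g] N_def root_def using n by auto
  have old: "d v = depth t v" if "v \<in> nodes t" for v
    using disj that by (auto simp: d_def)
  have new: "d v = Suc (depth t p)" if "v \<in> N" for v
    using that by (simp add: d_def)
  have c: "depth_certificate t (depth t)" using grown_treeD(2)[OF g] .
  have sub: "edges t ^^ k \<subseteq> edges ?t ^^ k" for k
    by (induction k) (auto simp: ed)
  have reach: "(root, v) \<in> edges ?t ^^ depth t v" if "v \<in> nodes t" for v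
    using c sub that unfolding depth_certificate_def by blast
  have "(root, v) \<in> edges ?t ^^ d v" if "v \<in> nodes ?t" for v
  proof (cases "v \<in> N")
    case True
    then have "(p, v) \<in> edges ?t" by (simp add: ed)
    with reach[OF p] show ?thesis unfolding new[OF True] by auto
  next
    case False
    with that show ?thesis by (simp add: nd old reach)
  qed
  moreover have "d v = Suc (d u)" if "(u, v) \<in> edges ?t" for u v
  proof (cases "v \<in> N")
    case True
    \<comment> \<open>Old edges end in old nodes, so an edge into \<open>N\<close> must be one of
      the new ones.\<close>
    have "u = p" using that True disj c unfolding ed depth_certificate_def by blast
    with True show ?thesis by (simp add: old p new)
  next
    case False
    then have uv: "(u, v) \<in> edges t" using that ed by blast
    then have "u \<in> nodes t" "v \<in> nodes t" "depth t v = Suc (depth t u)"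
      using c unfolding depth_certificate_def by auto
    then show ?thesis by (simp add: old)
  qed
  moreover have "d root = 0"
    using old[OF grown_tree_nodes(2)[OF g]] c by (simp add: depth_certificate_def)
  moreover have "edges ?t \<subseteq> nodes ?t \<times> nodes ?t"
    using c p unfolding nd ed depth_certificate_def by blast
  ultimately show cert: "depth_certificate ?t d"
    unfolding depth_certificate_def by blast
  show "depth ?t v = d v" if "v \<in> nodes t \<union> N" for v
    using depth_eq_certificate[OF cert] that nd by simp
qed

text \<open>Old depths are unchanged and all \<open>m\<close> new nodes share the depth
  \<open>Suc (depth t p)\<close>. This yields both the invariant and the increment of the path
  length.\<close>

lemma grown_tree_attach:
  assumes g: "grown_tree m n t" and p: "p \<in> nodes t" and n: "n \<ge> 1"
  shows "grown_tree m (Suc n) (attach m (Suc n) p t)"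
    and "internal_path_length (attach m (Suc n) p t)
      = internal_path_length t + m * Suc (depth t p)"
proof -
  define N where "N = {Suc n} \<times> {..<m}"
  let ?t = "attach m (Suc n) p t"
  note da = depth_attach[OF g p n, folded N_def]
  have nd: "nodes ?t = nodes t \<union> N"
    by (auto simp: attach_def N_def Let_def)
  have old: "depth ?t v = depth t v" if "v \<in> nodes t" for v
    using da(2)[of v] da(3) that by auto
  have new: "depth ?t v = Suc (depth t p)" if "v \<in> N" for v
    using da(2)[of v] that by auto
  note nodes_t = grown_treeD(1)[OF g]
  have "{2..Suc n} = insert (Suc n) {2..n}" using n by auto
  then have nodes_attach: "nodes ?t = insert root ({2..Suc n} \<times> {..<m})"
    unfolding nd nodes_t N_def by auto
  have "depth_certificate ?t (depth ?t)"
    using depth_certificate_depth[OF da(1)] grown_tree_nodes(2)[OF g] by (simp add: nd)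
  moreover have "depth ?t u = depth ?t v"
    if uv: "u \<in> nodes ?t" "v \<in> nodes ?t" "label u = label v" for u v
  proof -
    \<comment> \<open>The label tells new nodes from old ones, so no mixed pair has to be
      compared.\<close>
    have "label w = Suc n \<longleftrightarrow> w \<in> N" if "w \<in> nodes ?t" for w
      using that n by (auto simp: nd nodes_t N_def label_def root_def)
    then have "u \<in> N \<longleftrightarrow> v \<in> N" using uv by metis
    then consider "u \<in> N" "v \<in> N" | "u \<in> nodes t" "v \<in> nodes t"
      using uv(1,2) unfolding nd by blast
    then show ?thesis
    proof cases
      case 1
      then show ?thesis by (simp add: new)
    next
      case 2
      then show ?thesis using grown_treeD(3)[OF g _ _ uv(3)] by (simp add: old)
    qed
  qed
  ultimately show "grown_tree m (Suc n) ?t"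
    unfolding grown_tree_def using nodes_attach by blast
  have "internal_path_length ?t = (\<Sum>v\<in>nodes t. depth ?t v) + (\<Sum>v\<in>N. depth ?t v)"
    unfolding internal_path_length_def nd
    by (rule sum.union_disjoint) (use grown_tree_nodes(1)[OF g] da(3) N_def in auto)
  then show "internal_path_length ?t = internal_path_length t + m * Suc (depth t p)"
    by (simp add: old new internal_path_length_def N_def card_cartesian_product)
qed

section \<open>The support of the random tree and its path length\<close>

lemma recursive_tree_Suc:
  assumes "n \<ge> 1"
  shows "recursive_tree m (Suc n) = bind_pmf (recursive_tree m n) (\<lambda>t.
     map_pmf (\<lambda>p. attach m (Suc n) p t) (pmf_of_set (nodes t)))"
  using assms by (cases n) simp_all

lemma grown_tree_recursive_tree:
  assumes "n \<ge> 1" "t \<in> set_pmf (recursive_tree m n)"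
  shows "grown_tree m n t"
  using assms
proof (induction n arbitrary: t rule: dec_induct)
  case base
  then show ?case using grown_tree_root by simp
next
  case (step n)
  then obtain s where s: "s \<in> set_pmf (recursive_tree m n)"
    and t: "t \<in> (\<lambda>p. attach m (Suc n) p s) ` set_pmf (pmf_of_set (nodes s))"
    unfolding recursive_tree_Suc[OF step.hyps(1)] by auto
  note g = step.IH[OF s]
  from t grown_tree_set_pmf[OF g] grown_tree_attach(1)[OF g _ step.hyps(1)] show ?case by auto
qed

text \<open>Finite support turns expectations into finite sums and settles integrability.\<close>

lemma finite_set_recursive_tree:
  assumes "n \<ge> 1"
  shows "finite (set_pmf (recursive_tree m n))"
  using assms
proof (induction n rule: dec_induct)
  case (step n)
  have "finite (set_pmf (pmf_of_set (nodes t)))" if "t \<in> set_pmf (recursive_tree m n)" for t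
    using grown_tree_recursive_tree[OF step.hyps(1) that]
    by (simp add: grown_tree_set_pmf grown_tree_nodes(1))
  with step.IH show ?case by (simp add: recursive_tree_Suc[OF step.hyps(1)])
qed simp

text \<open>Each label from 2 to \<open>n\<close> has exactly \<open>m\<close> bearers. Label 1 has
  only one, but is harmless in the sum because its depth is 0.\<close>

lemma path_length_eq_label_depths:
  assumes m: "m \<ge> 1" and n: "n \<ge> 1" and g: "grown_tree m n t"
  shows "m * (\<Sum>k=1..n. label_depth t k) = internal_path_length t"
proof -
  note nodes_t = grown_treeD(1)[OF g]
  have root0: "depth t root = 0"
    using grown_treeD(2)[OF g] by (simp add: depth_certificate_def)
  have ld: "label_depth t (label v) = depth t v" if "v \<in> nodes t" for v
    unfolding label_depth_def
    by (rule the_equality) (use grown_treeD(3)[OF g] that in blast)+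
  have "label_depth t 1 = 0"
    using ld[of root] root0 nodes_t by (simp add: label_def root_def)
  then have "(\<Sum>k=1..n. label_depth t k) = (\<Sum>k=2..n. label_depth t k)"
    using n by (simp add: sum.atLeast_Suc_atMost numeral_2_eq_2)
  moreover have "internal_path_length t = (\<Sum>v\<in>{2..n} \<times> {..<m}. depth t v)"
    using root0 by (simp add: internal_path_length_def nodes_t root_def)
  moreover have "(\<Sum>v\<in>{2..n} \<times> {..<m}. depth t v) = (\<Sum>(k, j)\<in>{2..n} \<times> {..<m}. label_depth t k)"
    by (rule sum.cong) (use ld nodes_t in \<open>force simp: label_def\<close>)+
  ultimately show ?thesis
    by (simp add: sum.cartesian_product[symmetric] sum_distrib_left)
qed

section \<open>The expected path length\<close>

text \<open>All trees in the support have the same number \<open>N\<close> of nodes. Hence the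
  conditional mean after one step is an affine function of the current path length with fixed
  coefficients, and the recursion closes on expectations.\<close>

lemma expectation_path_length_Suc:
  fixes m n :: nat
  assumes n: "n \<ge> 1"
  defines "E \<equiv> \<lambda>n. measure_pmf.expectation (recursive_tree m n) (\<lambda>t. real (internal_path_length t))"
    and "N \<equiv> real m * (real n - 1) + 1"
  shows "E (Suc n) = E n * ((N + real m) / N) + real m"
proof -
  let ?R = "recursive_tree m n"
  have step: "measure_pmf.expectation (map_pmf (\<lambda>p. attach m (Suc n) p t) (pmf_of_set (nodes t)))
      (\<lambda>t. real (internal_path_length t)) = real (internal_path_length t) * ((N + real m) / N) + real m"
    if "t \<in> set_pmf ?R" for t
  proof -
    note g = grown_tree_recursive_tree[OF n that]
    note nd = grown_tree_nodes[OF g]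
    have N: "real (card (nodes t)) = N" 
      using n by (simp add: nd(3) N_def of_nat_diff)
    then have "N > 0" using nd(3) by linarith
    have "measure_pmf.expectation (map_pmf (\<lambda>p. attach m (Suc n) p t) (pmf_of_set (nodes t)))
        (\<lambda>t. real (internal_path_length t))
      = (\<Sum>p\<in>nodes t. real (internal_path_length (attach m (Suc n) p t))) / N"
      using nd N by (subst integral_map_pmf, subst integral_pmf_of_set) auto
    also have "(\<Sum>p\<in>nodes t. real (internal_path_length (attach m (Suc n) p t)))
      = (\<Sum>p\<in>nodes t. real (internal_path_length t) + real m + real m * real (depth t p))"
      by (rule sum.cong) (simp_all add: grown_tree_attach(2)[OF g _ n] algebra_simps)
    \<comment> \<open>The depths of all candidates \<open>p\<close> add up to the path length
      itself.\<close>
    also have "\<dots> = N * (real (internal_path_length t) + real m) + real m * real (internal_path_length t)"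
      by (simp add: sum.distrib N internal_path_length_def sum_distrib_left algebra_simps)
    finally show ?thesis
      using \<open>N > 0\<close> by (simp add: field_simps)
  qed
  have fin: "finite (set_pmf ?R)" using finite_set_recursive_tree[OF n] .
  have fin': "finite (set_pmf (map_pmf (\<lambda>p. attach m (Suc n) p t) (pmf_of_set (nodes t))))"
    if "t \<in> set_pmf ?R" for t
    using grown_tree_recursive_tree[OF n that]
    by (simp add: grown_tree_set_pmf grown_tree_nodes(1))
  have "E (Suc n) = (\<Sum>t\<in>set_pmf ?R. pmf ?R t *\<^sub>R
      (real (internal_path_length t) * ((N + real m) / N) + real m))"
    unfolding E_def recursive_tree_Suc[OF n]
    by (subst pmf_expectation_bind[OF fin fin']) (auto intro!: sum.cong simp: step simp del: integral_map_pmf)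
  also have "\<dots> = measure_pmf.expectation ?R
      (\<lambda>t. real (internal_path_length t) * ((N + real m) / N) + real m)"
    by (rule integral_measure_pmf[OF fin, symmetric]) auto
  also have "\<dots> = E n * ((N + real m) / N) + real m"
    unfolding E_def
    by (subst Bochner_Integration.integral_add) (auto intro: integrable_measure_pmf_finite[OF fin])
  finally show ?thesis .
qed

lemma expectation_path_length:
  assumes m: "m \<ge> 1" and n: "n \<ge> 1"
  shows "measure_pmf.expectation (recursive_tree m n) (\<lambda>t. real (internal_path_length t))
    = (real m * (real n - 1) + 1) * gen_harm (n - 1) (1 / real m)"
  using n
proof (induction n rule: dec_induct)
  case base
  have "depth (Tree {root} {}) root = 0"
    using grown_tree_root by (simp add: grown_tree_def depth_certificate_def)
  then show ?case by (simp add: gen_harm_def internal_path_length_def)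
next
  case (step n)
  define N where "N = real m * (real n - 1) + 1"
  have N: "N > 0" "N + real m = real m * real n + 1"
    using step.hyps(1) by (simp add: N_def add_nonneg_pos, simp add: N_def algebra_simps)
  \<comment> \<open>The last summand is \<open>1 / (n + 1/m) = m / (m n + 1)\<close>, and
    \<open>m n + 1\<close> is the next node count \<open>N + m\<close>.\<close>
  have "gen_harm n (1 / real m) = gen_harm (n - 1) (1 / real m) + real m / (N + real m)"
    using m step.hyps unfolding N(2) by (cases n) (simp_all add: gen_harm_def field_simps)
  moreover have "N + real m > 0" using N(1) by simp
  ultimately show ?case
    using N unfolding expectation_path_length_Suc[OF step.hyps(1)] step.IH
    by (simp add: field_simps flip: N_def)
qed

section \<open>The digamma limit and the expansion\<close>

text \<open>This is the limit formula for \<open>Digamma\<close> at \<open>1 + y\<close>, whose sum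
  starts at index 0 where \<open>gen_harm\<close> starts at 1. Passing from \<open>n\<close> to
  \<open>n - 1\<close> costs one vanishing summand.\<close>

lemma gen_harm_asymptotics:
  assumes "y > 0"
  shows "(\<lambda>n. ln (real n) - gen_harm (n - 1) y) \<longlonglongrightarrow> Digamma (1 + y)"
proof -
  have harm: "gen_harm n y = (\<Sum>k<n. inverse (1 + y + real k))" for n
    by (induction n) (simp_all add: gen_harm_def inverse_eq_divide add_ac)
  have "(\<lambda>n. ln (real n) - gen_harm n y) \<longlonglongrightarrow> Digamma (1 + y)"
    unfolding harm using Digamma_LIMSEQ[of "1 + y"] assms by (simp add: add_ac)
  moreover have "(\<lambda>n. 1 / (real n + y)) \<longlonglongrightarrow> 0" by real_asymp
  ultimately have "(\<lambda>n. ln (real n) - gen_harm n y + 1 / (real n + y)) \<longlonglongrightarrow> Digamma (1 + y) + 0"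
    by (rule tendsto_add)
  \<comment> \<open>Positive \<open>n\<close> is required: at 0 the truncated \<open>n - 1\<close>
    removes no summand.\<close>
  moreover have "\<forall>\<^sub>F n in sequentially.
      ln (real n) - gen_harm n y + 1 / (real n + y) = ln (real n) - gen_harm (n - 1) y"
    using eventually_gt_at_top[of 0]
  proof eventually_elim
    case (elim n)
    then show ?case by (cases n) (simp_all add: gen_harm_def)
  qed
  ultimately show ?thesis by (simp only: tendsto_cong add_0_right)
qed

theorem corollary4p3:
  fixes m :: nat and P :: "nat \<Rightarrow> tree \<Rightarrow> nat"
  assumes m: "m \<ge> 1"
    and P: "\<And>n t. P n t = m * (\<Sum>k=1..n. label_depth t k)"
  shows "(\<forall>n\<ge>1. \<forall>t\<in>set_pmf (recursive_tree m n). P n t = internal_path_length t) \<and>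
         (\<forall>n\<ge>1. measure_pmf.expectation (recursive_tree m n) (\<lambda>t. real (P n t)) =
           (real m * (real n - 1) + 1) * gen_harm (n - 1) (1 / real m)) \<and>
         (\<lambda>n. measure_pmf.expectation (recursive_tree m n) (\<lambda>t. real (P n t)) -
           (real m * real n * ln (real n) - real m * Digamma ((real m + 1) / real m) * real n))
         \<in> o(\<lambda>n. real n)"
proof (intro conjI)
  have path: "P n t = internal_path_length t"
    if "n \<ge> 1" "t \<in> set_pmf (recursive_tree m n)" for n t
    unfolding P using path_length_eq_label_depths[OF m that(1) grown_tree_recursive_tree[OF that]] .
  then show "\<forall>n\<ge>1. \<forall>t\<in>set_pmf (recursive_tree m n). P n t = internal_path_length t"
    by blast
  have mean: "measure_pmf.expectation (recursive_tree m n) (\<lambda>t. real (P n t)) =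
      (real m * (real n - 1) + 1) * gen_harm (n - 1) (1 / real m)" if n: "n \<ge> 1" for n
  proof -
    have "measure_pmf.expectation (recursive_tree m n) (\<lambda>t. real (P n t))
      = measure_pmf.expectation (recursive_tree m n) (\<lambda>t. real (internal_path_length t))"
      by (rule integral_cong_AE) (auto simp: AE_measure_pmf_iff path[OF n])
    then show ?thesis using expectation_path_length[OF m n] by simp
  qed
  then show "\<forall>n\<ge>1. measure_pmf.expectation (recursive_tree m n) (\<lambda>t. real (P n t)) =
      (real m * (real n - 1) + 1) * gen_harm (n - 1) (1 / real m)"
    by blast
  define \<psi> where "\<psi> = Digamma ((real m + 1) / real m)"
  \<comment> \<open>The error in the harmonic limit, so that the harmonic factor of the mean is
    \<open>ln n - \<psi> - r n\<close>.\<close>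
  define r where "r n = ln (real n) - gen_harm (n - 1) (1 / real m) - \<psi>" for n
  have "(real m + 1) / real m = 1 + 1 / real m" using m by (simp add: field_simps)
  then have r: "r \<longlonglongrightarrow> 0"
    using gen_harm_asymptotics[of "1 / real m"] m
    unfolding r_def \<psi>_def by (simp add: LIM_zero)
  \<comment> \<open>With \<open>L = ln n - \<psi>\<close>, the error of the expansion is
    \<open>(m n + 1 - m) (L - r n) - m n L\<close>. Divided by \<open>n\<close>, it splits into this
    term and, subtracted, the one below.\<close>
  have "(\<lambda>n. (1 - real m) * ((ln (real n) - \<psi>) / real n)) \<longlonglongrightarrow> (1 - real m) * 0"
    by (intro tendsto_intros) real_asymp
  moreover have "(\<lambda>n. (real m + (1 - real m) * (1 / real n)) * r n)
      \<longlonglongrightarrow> (real m + (1 - real m) * 0) * 0"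
    by (intro tendsto_intros r)
  ultimately have lim: "(\<lambda>n. (1 - real m) * ((ln (real n) - \<psi>) / real n)
      - (real m + (1 - real m) * (1 / real n)) * r n) \<longlonglongrightarrow> 0"
    by (auto dest: tendsto_diff)
  show "(\<lambda>n. measure_pmf.expectation (recursive_tree m n) (\<lambda>t. real (P n t)) -
      (real m * real n * ln (real n) - real m * Digamma ((real m + 1) / real m) * real n))
      \<in> o(\<lambda>n. real n)"
  proof (rule smalloI_tendsto)
    show "\<forall>\<^sub>F n in sequentially. real n \<noteq> 0"
      using eventually_gt_at_top[of 0] by eventually_elim simp
    show "(\<lambda>n. (measure_pmf.expectation (recursive_tree m n) (\<lambda>t. real (P n t)) -
        (real m * real n * ln (real n) - real m * Digamma ((real m + 1) / real m) * real n))
        / real n) \<longlonglongrightarrow> 0"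
    proof (rule Lim_transform_eventually[OF lim])
      show "\<forall>\<^sub>F n in sequentially. (1 - real m) * ((ln (real n) - \<psi>) / real n)
          - (real m + (1 - real m) * (1 / real n)) * r n
        = (measure_pmf.expectation (recursive_tree m n) (\<lambda>t. real (P n t)) -
          (real m * real n * ln (real n) - real m * Digamma ((real m + 1) / real m) * real n))
          / real n"
        \<comment> \<open>Both the exact mean and the division by \<open>n\<close> need
          \<open>n \<ge> 1\<close>.\<close>
        using eventually_ge_at_top[of 1]
      proof eventually_elim
        case (elim n)
        then show ?case
          unfolding mean[OF elim] r_def by (fold \<psi>_def) (simp add: field_simps)
      qed
    qed
  qed
qed

end
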